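(* Let $(\Omega,\Sigma,P)$ be a probability space and let $E$ be a set. For a measurable map $X:\Omega\to\mathbb{R}^E$ and $e\in E$ let $\kappa X(e):\Omega\to\mathbb{R}$ be the function $\kappa X(e)(\omega)=X(\omega)(e)$. Then the map $\kappa$ does not depend on the choice of representatives (if $X_1$ and $X_2$ represent the same class in $L^0(\Omega\!:\!\mathbb{R}^E)$, then for every $e\in E$ the functions $\kappa X_1(e)$ and $\kappa X_2(e)$ represent the same class in $L^0(\Omega)$), thus it induces a map \[ \kappa: L^0(\Omega\!:\!\mathbb{R}^E)\to (L^0(\Omega))^E,\qquad [X]\mapsto \big([\kappa X(e)]\big)_{e\in E}, \] and this map $\kappa$ is surjective.
   Context: $\mathbb{R}^E$ is the set of all maps $E\to\mathbb{R}$, equipped with the Kolmogorov $\sigma$-algebra $\mathcal{B}_K(\mathbb{R}^E)$ generated by the sets $\pi_e^{-1}(B)$, $e\in E$, $B\in\mathcal{B}(\mathbb{R})$ (Borel sets), where $\pi_e:\mathbb{R}^E\to\mathbb{R}$, $\pi_e(f)=f(e)$. $L^0(\Omega)$ is the space of measurable functions $(\Omega,\Sigma)\to(\mathbb{R},\mathcal{B}(\mathbb{R}))$ modulo $P$-almost sure equality. All representatives are defined on all of $\Omega$ and finite-valued. $L^0(\Omega\!:\!\mathbb{R}^E)$ is the set of measurable maps $(\Omega,\Sigma)\to(\mathbb{R}^E,\mathcal{B}_K(\mathbb{R}^E))$ modulo strict equivalence: $X_1$ and $X_2$ are strictly equivalent if there is a single set $\Omega_1\subset\Omega$ with $P(\Omega_1)=1$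 such that $X_1(\omega)=X_2(\omega)$ (as elements of $\mathbb{R}^E$, i.e. $X_1(\omega)(e)=X_2(\omega)(e)$ for all $e\in E$) for all $\omega\in\Omega_1$. $(L^0(\Omega))^E$ is the set of all maps $E\to L^0(\Omega)$. *)

theory Defs
  imports "HOL-Probability.Probability"
begin

text \<open>
  The maps from \<open>E\<close> to the reals are the extensional functions \<open>E \<rightarrow>\<^sub>E UNIV\<close>, and the
  library's product sigma-algebra on them is the Kolmogorov sigma-algebra: by
  \<open>sets_kolmogorov\<close> it is generated by the preimages of Borel sets under the evaluations.
\<close>

abbreviation kolmogorov :: "'e set \<Rightarrow> ('e \<Rightarrow> real) measure" where
  "kolmogorov E \<equiv> PiM E (\<lambda>_. borel)"

lemma space_kolmogorov: "space (kolmogorov E) = (E \<rightarrow>\<^sub>E UNIV)"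
  by (simp add: space_PiM)

lemma sets_kolmogorov:
  "sets (kolmogorov E) =
     sigma_sets (E \<rightarrow>\<^sub>E UNIV) {{f \<in> E \<rightarrow>\<^sub>E UNIV. f e \<in> B} | e B. e \<in> E \<and> B \<in> sets borel}"
  by (simp add: sets_PiM_single)

text \<open>
  HOL functions are total on the type, so a representative also carries values outside
  \<open>space M\<close>. Neither relation below looks at them, hence the quotients are those of the
  functions defined on \<open>space M\<close> only.
\<close>

definition as_eq :: "'a measure \<Rightarrow> (('a \<Rightarrow> real) \<times> ('a \<Rightarrow> real)) set" where
  "as_eq M = {(f, g). f \<in> borel_measurable M \<and> g \<in> borel_measurable M \<and>
                      (AE \<omega> in M. f \<omega> = g \<omega>)}"

definition strict_eq ::
    "'a measure \<Rightarrow> 'e set \<Rightarrow> (('a \<Rightarrow> 'e \<Rightarrow> real) \<times> ('a \<Rightarrow> 'e \<Rightarrow> real)) set" where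
  "strict_eq M E = {(X, Y). X \<in> M \<rightarrow>\<^sub>M kolmogorov E \<and> Y \<in> M \<rightarrow>\<^sub>M kolmogorov E \<and>
     (\<exists>\<Omega>\<^sub>1\<in>sets M. measure M \<Omega>\<^sub>1 = 1 \<and> (\<forall>\<omega>\<in>\<Omega>\<^sub>1. X \<omega> = Y \<omega>))}"

lemma equiv_as_eq: "equiv (borel_measurable M) (as_eq M)"
  unfolding as_eq_def
  by (intro equivI refl_onI symI transI) (auto elim: AE_mp)

lemma equiv_strict_eq:
  assumes "prob_space M"
  shows "equiv (M \<rightarrow>\<^sub>M kolmogorov E) (strict_eq M E)"
proof (intro equivI refl_onI symI transI)
  interpret prob_space M by fact
  show "strict_eq M E \<subseteq> (M \<rightarrow>\<^sub>M kolmogorov E) \<times> (M \<rightarrow>\<^sub>M kolmogorov E)"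
    by (auto simp: strict_eq_def)
  show "(X, X) \<in> strict_eq M E" if "X \<in> M \<rightarrow>\<^sub>M kolmogorov E" for X
    using that prob_space by (auto simp: strict_eq_def)
  show "(Y, X) \<in> strict_eq M E" if "(X, Y) \<in> strict_eq M E" for X Y
    using that by (force simp: strict_eq_def)
  show "(X, Z) \<in> strict_eq M E"
    if XY: "(X, Y) \<in> strict_eq M E" and YZ: "(Y, Z) \<in> strict_eq M E" for X Y Z
  proof -
    obtain A B where A: "A \<in> sets M" "prob A = 1" "\<forall>\<omega>\<in>A. X \<omega> = Y \<omega>"
      and B: "B \<in> sets M" "prob B = 1" "\<forall>\<omega>\<in>B. Y \<omega> = Z \<omega>"
      using XY YZ by (auto simp: strict_eq_def)
    have "prob (A \<inter> B) = 1"
      using A B measure_Un3[of A M B] prob_le_1[of "A \<union> B"] prob_le_1[of "A \<inter> B"]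
      by (simp add: fmeasurable_eq_sets)
    then show ?thesis
      using XY YZ A B by (auto simp: strict_eq_def intro!: bexI[of _ "A \<inter> B"])
  qed
qed

definition L0 :: "'a measure \<Rightarrow> ('a \<Rightarrow> real) set set" where
  "L0 M = borel_measurable M // as_eq M"

definition L0_class :: "'a measure \<Rightarrow> ('a \<Rightarrow> real) \<Rightarrow> ('a \<Rightarrow> real) set" where
  "L0_class M f = as_eq M `` {f}"

definition L0_fun :: "'a measure \<Rightarrow> 'e set \<Rightarrow> ('a \<Rightarrow> 'e \<Rightarrow> real) set set" where
  "L0_fun M E = (M \<rightarrow>\<^sub>M kolmogorov E) // strict_eq M E"

definition L0_fun_class ::
    "'a measure \<Rightarrow> 'e set \<Rightarrow> ('a \<Rightarrow> 'e \<Rightarrow> real) \<Rightarrow> ('a \<Rightarrow> 'e \<Rightarrow> real) set" where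
  "L0_fun_class M E X = strict_eq M E `` {X}"

definition kappa_rep :: "('a \<Rightarrow> 'e \<Rightarrow> real) \<Rightarrow> 'e \<Rightarrow> 'a \<Rightarrow> real" where
  "kappa_rep X e = (\<lambda>\<omega>. X \<omega> e)"

text \<open>
  The value of the induced map at a class \<open>C\<close> is the common value at all representatives in
  \<open>C\<close>. That there is such a common value has to be proved.
\<close>

definition kappa ::
    "'a measure \<Rightarrow> 'e set \<Rightarrow> ('a \<Rightarrow> 'e \<Rightarrow> real) set \<Rightarrow> 'e \<Rightarrow> ('a \<Rightarrow> real) set" where
  "kappa M E C = the_elem ((\<lambda>X. \<lambda>e\<in>E. L0_class M (kappa_rep X e)) ` C)"

end

theory Submission
  imports Defs
begin

text \<open>
  Strict equivalence asks for one almost sure event on which all coordinates agree at once, so it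
  implies almost sure equality of each coordinate. This makes the induced map well defined
  (\<open>strict_eq_imp_as_eq_kappa_rep\<close>, \<open>kappa_L0_fun_class\<close>). For uncountable \<open>E\<close> the
  converse implication can fail, and then the map is not injective.

  Surjectivity rests on the choice of one representative for each coordinate of a given family of
  classes. Every representative is finite on all of \<open>\<Omega>\<close>, so together they
  form a map into the full product, without any exceptional null set to discard. This map is
  measurable however large \<open>E\<close> is, because the Kolmogorov \<open>\<sigma>\<close>-algebra is the one generated by
  the evaluations, so that measurability only has to be tested one coordinate at a time
  (\<open>ex_measurable_with_kappa_classes\<close>).
\<close>

lemma kappa_rep_measurable:
  assumes "X \<in> M \<rightarrow>\<^sub>M kolmogorov E" "e \<in> E"
  shows "kappa_rep X e \<in> borel_measurable M"
  unfolding kappa_rep_def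
  using measurable_compose[OF assms(1) measurable_component_singleton[OF assms(2)]] .

lemma strict_eq_imp_as_eq_kappa_rep:
  assumes "prob_space M" and XY: "(X, Y) \<in> strict_eq M E" and "e \<in> E"
  shows "(kappa_rep X e, kappa_rep Y e) \<in> as_eq M"
proof -
  interpret prob_space M by fact
  obtain A where A: "prob A = 1" "\<forall>\<omega>\<in>A. X \<omega> = Y \<omega>"
    using XY by (auto simp: strict_eq_def)
  have "AE \<omega> in M. kappa_rep X e \<omega> = kappa_rep Y e \<omega>"
    using AE_prob_1[OF A(1)] by eventually_elim (use A(2) in \<open>auto simp: kappa_rep_def\<close>)
  with XY \<open>e \<in> E\<close> show ?thesis
    by (auto simp: as_eq_def strict_eq_def intro: kappa_rep_measurable)
qed

lemma L0_class_eqI: "(f, g) \<in> as_eq M \<Longrightarrow> L0_class M f = L0_class M g"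
  unfolding L0_class_def by (rule equiv_class_eq[OF equiv_as_eq])

lemma kappa_L0_fun_class:
  assumes M: "prob_space M" and X: "X \<in> M \<rightarrow>\<^sub>M kolmogorov E"
  shows "kappa M E (L0_fun_class M E X) = (\<lambda>e\<in>E. L0_class M (kappa_rep X e))"
  unfolding kappa_def
proof (rule the_elem_image_unique)
  show "L0_fun_class M E X \<noteq> {}"
    using equiv_class_self[OF equiv_strict_eq[OF M] X] by (auto simp: L0_fun_class_def)
  show "(\<lambda>e\<in>E. L0_class M (kappa_rep Y e)) = (\<lambda>e\<in>E. L0_class M (kappa_rep X e))"
    if "Y \<in> L0_fun_class M E X" for Y
    using that by (intro restrict_ext)
      (auto simp: L0_fun_class_def
        intro!: L0_class_eqI[symmetric] strict_eq_imp_as_eq_kappa_rep[OF M])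
qed

lemma L0_class_in_L0: "f \<in> borel_measurable M \<Longrightarrow> L0_class M f \<in> L0 M"
  unfolding L0_def L0_class_def by (rule quotientI)

lemma L0_fun_class_in_L0_fun: "X \<in> M \<rightarrow>\<^sub>M kolmogorov E \<Longrightarrow> L0_fun_class M E X \<in> L0_fun M E"
  unfolding L0_fun_def L0_fun_class_def by (rule quotientI)

lemma L0_cases:
  assumes "C \<in> L0 M"
  obtains f where "f \<in> borel_measurable M" "C = L0_class M f"
  using assms unfolding L0_def L0_class_def by (rule quotientE)

lemma L0_fun_cases:
  assumes "C \<in> L0_fun M E"
  obtains X where "X \<in> M \<rightarrow>\<^sub>M kolmogorov E" "C = L0_fun_class M E X"
  using assms unfolding L0_fun_def L0_fun_class_def by (rule quotientE)

text \<open>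
  The choice of representatives meets no consistency condition, since any family of real numbers
  indexed by \<open>E\<close> is a point of the product.
\<close>

lemma ex_measurable_with_kappa_classes:
  assumes F: "F \<in> E \<rightarrow>\<^sub>E L0 M"
  obtains X where "X \<in> M \<rightarrow>\<^sub>M kolmogorov E" "(\<lambda>e\<in>E. L0_class M (kappa_rep X e)) = F"
proof -
  have "\<forall>e\<in>E. \<exists>f. f \<in> borel_measurable M \<and> F e = L0_class M f"
    using PiE_mem[OF F] by (meson L0_cases)
  from bchoice[OF this] obtain g where g: "\<forall>e\<in>E. g e \<in> borel_measurable M \<and> F e = L0_class M (g e)"
    by blast
  define X where "X = (\<lambda>\<omega>. \<lambda>e\<in>E. g e \<omega>)"
  have "kappa_rep X e = g e" if "e \<in> E" for e
    using that by (simp add: kappa_rep_def X_def)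
  then have "(\<lambda>e\<in>E. L0_class M (kappa_rep X e)) = F"
    using g F by (intro ext) (simp add: restrict_def PiE_arb[OF F])
  moreover have "X \<in> M \<rightarrow>\<^sub>M kolmogorov E"
    unfolding X_def using g by (intro measurable_restrict) simp
  ultimately show thesis
    using that by blast
qed

theorem corollary3p3:
  fixes M :: "'a measure" and E :: "'e set"
  assumes "prob_space M"
  shows "(\<forall>X \<in> M \<rightarrow>\<^sub>M kolmogorov E. \<forall>e\<in>E. kappa_rep X e \<in> borel_measurable M) \<and>
    (\<forall>X\<^sub>1 \<in> M \<rightarrow>\<^sub>M kolmogorov E. \<forall>X\<^sub>2 \<in> M \<rightarrow>\<^sub>M kolmogorov E.
       L0_fun_class M E X\<^sub>1 = L0_fun_class M E X\<^sub>2 \<longrightarrow>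
       (\<forall>e\<in>E. L0_class M (kappa_rep X\<^sub>1 e) = L0_class M (kappa_rep X\<^sub>2 e))) \<and>
    kappa M E \<in> L0_fun M E \<rightarrow> (E \<rightarrow>\<^sub>E L0 M) \<and>
    (\<forall>X \<in> M \<rightarrow>\<^sub>M kolmogorov E.
       kappa M E (L0_fun_class M E X) = (\<lambda>e\<in>E. L0_class M (kappa_rep X e))) \<and>
    kappa M E ` L0_fun M E = (E \<rightarrow>\<^sub>E L0 M)"
proof (intro conjI ballI impI)
  note M = \<open>prob_space M\<close>
  show "kappa_rep X e \<in> borel_measurable M" if "X \<in> M \<rightarrow>\<^sub>M kolmogorov E" "e \<in> E" for X e
    using that by (rule kappa_rep_measurable)
  show "L0_class M (kappa_rep X\<^sub>1 e) = L0_class M (kappa_rep X\<^sub>2 e)"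
    if "X\<^sub>2 \<in> M \<rightarrow>\<^sub>M kolmogorov E" "L0_fun_class M E X\<^sub>1 = L0_fun_class M E X\<^sub>2" "e \<in> E"
    for X\<^sub>1 X\<^sub>2 e
  proof -
    have "(X\<^sub>1, X\<^sub>2) \<in> strict_eq M E"
      using that(2) equiv_strict_eq[OF M] that(1) unfolding L0_fun_class_def
      by (rule eq_equiv_class)
    then show ?thesis
      using that(3) by (intro L0_class_eqI strict_eq_imp_as_eq_kappa_rep[OF M])
  qed
  show kappa: "kappa M E (L0_fun_class M E X) = (\<lambda>e\<in>E. L0_class M (kappa_rep X e))"
    if "X \<in> M \<rightarrow>\<^sub>M kolmogorov E" for X
    using M that by (rule kappa_L0_fun_class)
  show into: "kappa M E \<in> L0_fun M E \<rightarrow> (E \<rightarrow>\<^sub>E L0 M)"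
  proof
    fix C assume "C \<in> L0_fun M E"
    then obtain X where X: "X \<in> M \<rightarrow>\<^sub>M kolmogorov E" "C = L0_fun_class M E X"
      by (rule L0_fun_cases)
    then show "kappa M E C \<in> E \<rightarrow>\<^sub>E L0 M"
      by (simp add: kappa L0_class_in_L0 kappa_rep_measurable[OF X(1)])
  qed
  show "kappa M E ` L0_fun M E = (E \<rightarrow>\<^sub>E L0 M)"
  proof
    show "kappa M E ` L0_fun M E \<subseteq> (E \<rightarrow>\<^sub>E L0 M)"
      using into by auto
    show "(E \<rightarrow>\<^sub>E L0 M) \<subseteq> kappa M E ` L0_fun M E"
    proof
      fix F assume "F \<in> E \<rightarrow>\<^sub>E L0 M"
      then obtain X where X: "X \<in> M \<rightarrow>\<^sub>M kolmogorov E"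
        and F: "(\<lambda>e\<in>E. L0_class M (kappa_rep X e)) = F"
        by (rule ex_measurable_with_kappa_classes)
      show "F \<in> kappa M E ` L0_fun M E"
        using imageI[OF L0_fun_class_in_L0_fun[OF X], of "kappa M E"] by (simp only: kappa[OF X] F)
    qed
  qed
qed

end
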